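(* Let $(G,I)$ be a single interval total sum game, i.e. $I$ is a single real interval. If Eve has a winning strategy then she has a finite memory winning strategy.
   Context: A game graph is a tuple $G=(V,V_\exists,E,w,q_0)$ where $(V,E)$ is a finite directed graph in which every vertex has an outgoing edge, $w:E\to\mathbb{Z}$ is an integer edge-weight function, $V_\exists\subseteq V$ are Eve's vertices (the rest are Adam's), and $q_0\in V$ the initial vertex. A play is an infinite path $\pi=v_0v_1\cdots$ with $v_0=q_0$; write $w(\pi[..k])=\sum_{i=0}^{k-1}w(v_i,v_{i+1})$. A strategy for a player maps finite play prefixes ending in one of that player's vertices to a successor vertex; it has finite memory if it can be realized as the output of a finite-state machine reading the play. The total sum payoff is $\underline{Total}(\pi)=\liminf_{k\to\infty}w(\pi[..k])\in\mathbb{Z}\cup\{\pm\infty\}$. A play is winning for Eve iff $\underline{Total}(\pi)\in I$; a strategy of Eve is winning if all consistent plays are winning for her. *)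

theory Defs
  imports Main "HOL-Library.Extended_Real" "HOL-Library.Liminf_Limsup"
begin

definition game_graph :: "'v set \<Rightarrow> 'v set \<Rightarrow> ('v \<times> 'v) set \<Rightarrow> 'v \<Rightarrow> bool" where
  "game_graph V VE E q0 \<longleftrightarrow> finite V \<and> E \<subseteq> V \<times> V \<and> (\<forall>v\<in>V. \<exists>u. (v, u) \<in> E)
     \<and> VE \<subseteq> V \<and> q0 \<in> V"

definition play :: "('v \<times> 'v) set \<Rightarrow> 'v \<Rightarrow> (nat \<Rightarrow> 'v) \<Rightarrow> bool" where
  "play E q0 \<pi> \<longleftrightarrow> \<pi> 0 = q0 \<and> (\<forall>i. (\<pi> i, \<pi> (Suc i)) \<in> E)"

definition history :: "('v \<times> 'v) set \<Rightarrow> 'v \<Rightarrow> 'v list \<Rightarrow> bool" where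
  "history E q0 h \<longleftrightarrow> h \<noteq> [] \<and> hd h = q0 \<and> (\<forall>i. Suc i < length h \<longrightarrow> (h ! i, h ! Suc i) \<in> E)"

definition eve_strategy :: "'v set \<Rightarrow> ('v \<times> 'v) set \<Rightarrow> 'v \<Rightarrow> ('v list \<Rightarrow> 'v) \<Rightarrow> bool" where
  "eve_strategy VE E q0 \<sigma> \<longleftrightarrow> (\<forall>h. history E q0 h \<and> last h \<in> VE \<longrightarrow> (last h, \<sigma> h) \<in> E)"

definition consistent :: "'v set \<Rightarrow> ('v list \<Rightarrow> 'v) \<Rightarrow> (nat \<Rightarrow> 'v) \<Rightarrow> bool" where
  "consistent VE \<sigma> \<pi> \<longleftrightarrow> (\<forall>i. \<pi> i \<in> VE \<longrightarrow> \<pi> (Suc i) = \<sigma> (map \<pi> [0..<Suc i]))"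

definition total :: "('v \<times> 'v \<Rightarrow> int) \<Rightarrow> (nat \<Rightarrow> 'v) \<Rightarrow> ereal" where
  "total w \<pi> = liminf (\<lambda>k. ereal (real_of_int (\<Sum>i<k. w (\<pi> i, \<pi> (Suc i)))))"

definition real_interval :: "real set \<Rightarrow> bool" where
  "real_interval I \<longleftrightarrow> (\<forall>x\<in>I. \<forall>z\<in>I. \<forall>y. x \<le> y \<and> y \<le> z \<longrightarrow> y \<in> I)"

definition winning_play :: "real set \<Rightarrow> ('v \<times> 'v \<Rightarrow> int) \<Rightarrow> (nat \<Rightarrow> 'v) \<Rightarrow> bool" where
  "winning_play I w \<pi> \<longleftrightarrow> total w \<pi> \<in> ereal ` I"

definition winning_strategy ::
  "'v set \<Rightarrow> ('v \<times> 'v) set \<Rightarrow> ('v \<times> 'v \<Rightarrow> int) \<Rightarrow> 'v \<Rightarrow> real set \<Rightarrow> ('v list \<Rightarrow> 'v) \<Rightarrow> bool" where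
  "winning_strategy VE E w q0 I \<sigma> \<longleftrightarrow> eve_strategy VE E q0 \<sigma> \<and>
     (\<forall>\<pi>. play E q0 \<pi> \<and> consistent VE \<sigma> \<pi> \<longrightarrow> winning_play I w \<pi>)"

definition finite_memory :: "'v set \<Rightarrow> ('v \<times> 'v) set \<Rightarrow> 'v \<Rightarrow> ('v list \<Rightarrow> 'v) \<Rightarrow> bool" where
  "finite_memory VE E q0 \<sigma> \<longleftrightarrow> (\<exists>(M :: nat set) m0 (upd :: nat \<Rightarrow> 'v \<Rightarrow> nat) (nxt :: nat \<Rightarrow> 'v \<Rightarrow> 'v).
     finite M \<and> m0 \<in> M \<and> (\<forall>m\<in>M. \<forall>v. upd m v \<in> M) \<and>
     (\<forall>h. history E q0 h \<and> last h \<in> VE \<longrightarrow> \<sigma> h = nxt (foldl upd m0 h) (last h)))"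

end

theory Submission
  imports Defs "HOL-Library.Sublist"
begin

text \<open>
  Let \<open>\<sigma>\<close> be winning and let a history close a loop if its last vertex occurred before at the same
  accumulated weight \<open>L \<in> I\<close>, with all weights in between at least \<open>L\<close>. Since the liminf of a
  play consistent with \<open>\<sigma>\<close> is an integer \<open>L \<in> I\<close>, each such play closes a loop, so by
  Koenig's lemma the tree of histories of \<open>\<sigma>\<close> cut at the first closed loop is finite. Eve
  remembers her node in this tree; instead of closing a loop she jumps back to its start, which
  preserves both the vertex and the accumulated weight. Let \<open>r\<close> have minimal weight \<open>L\<close> among the nodes
  visited infinitely often. To return to \<open>r\<close> she must jump out of the subtree of \<open>r\<close>, and the loop
  closed by that jump passes through \<open>r\<close>; its minimum is in \<open>I\<close>, is at most \<open>L\<close>, and, being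
  attained after the jump, is at least \<open>L\<close>. Hence the liminf \<open>L\<close> is in \<open>I\<close>.
\<close>

section \<open>General facts: Koenig's lemma, integer limits inferior, finite machines\<close>

text \<open>Over a finite alphabet, a node with infinitely many extensions in \<open>T\<close> has a
  one-letter extension of the same kind. Following such nodes from the root yields an infinite
  branch.\<close>

lemma koenig_lists:
  fixes T :: "'a list set"
  assumes "finite V" and sub: "T \<subseteq> lists V" and inf: "infinite T"
    and closed: "\<And>h v. h @ [v] \<in> T \<Longrightarrow> h \<in> T"
  shows "\<exists>\<pi>. \<forall>n. map \<pi> [0..<n] \<in> T"
proof -
  define P where "P h \<longleftrightarrow> infinite {t \<in> T. prefix h t}" for h
  have pre: "h \<in> T" if "h @ t \<in> T" for h t
    using that
  proof (induction t rule: rev_induct)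
    case (snoc x xs)
    then show ?case using closed[of "h @ xs" x] by simp
  qed simp
  have P_Nil: "P []" using inf by (simp add: P_def)
  have P_step: "\<exists>v. P (h @ [v])" if "P h" for h
  proof (rule ccontr)
    assume "\<nexists>v. P (h @ [v])"
    then have "finite (insert h (\<Union>v\<in>V. {t \<in> T. prefix (h @ [v]) t}))"
      using \<open>finite V\<close> by (auto simp: P_def)
    moreover have "{t \<in> T. prefix h t} \<subseteq> insert h (\<Union>v\<in>V. {t \<in> T. prefix (h @ [v]) t})"
    proof
      fix t assume t: "t \<in> {t \<in> T. prefix h t}"
      then obtain s where s: "t = h @ s" by (auto simp: prefix_def)
      show "t \<in> insert h (\<Union>v\<in>V. {t \<in> T. prefix (h @ [v]) t})"
      proof (cases s)
        case (Cons v s')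
        then have "v \<in> V" using t s sub by auto
        then show ?thesis using t s Cons by (auto simp: prefix_def)
      qed (use s in simp)
    qed
    ultimately show False using that finite_subset unfolding P_def by blast
  qed
  \<comment> \<open>The clause for \<open>n = 0\<close> forces the chosen chain to start at the
    root.\<close>
  obtain f where f: "\<And>n. P (f n)" "f 0 = []" "\<And>n. \<exists>v. f (Suc n) = f n @ [v]"
    using dependent_nat_choice[of "\<lambda>n h. P h \<and> (n = 0 \<longrightarrow> h = [])" "\<lambda>_ h h'. \<exists>v. h' = h @ [v]"]
      P_Nil P_step by (metis old.nat.distinct(2))
  obtain \<pi> where \<pi>: "\<And>n. f (Suc n) = f n @ [\<pi> n]" using f(3) by metis
  have "f n = map \<pi> [0..<n]" for n
    by (induction n) (auto simp: f(2) \<pi>)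
  moreover have "f n \<in> T" for n
  proof -
    have "{t \<in> T. prefix (f n) t} \<noteq> {}" using f(1)[of n] unfolding P_def by force
    then show ?thesis using pre by (auto simp: prefix_def)
  qed
  ultimately show ?thesis by metis
qed

text \<open>Integers are discrete: a sequence eventually above \<open>L - 1\<close> is eventually at
  least \<open>L\<close>, and if it took the value \<open>L\<close> only finitely often, it would
  eventually be at least \<open>L + 1\<close>, too high for its limit inferior.\<close>

lemma liminf_int_sequence_iff:
  fixes S :: "nat \<Rightarrow> int" and x :: real
  shows "liminf (\<lambda>k. ereal (real_of_int (S k))) = ereal x \<longleftrightarrow>
    (\<exists>L. x = real_of_int L \<and> (\<forall>\<^sub>F k in sequentially. L \<le> S k) \<and> (\<exists>\<^sub>F k in sequentially. S k = L))"
    (is "?l \<longleftrightarrow> ?r")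
proof
  assume l: ?l
  define L where "L = \<lceil>x\<rceil>"
  have "ereal (real_of_int (L - 1)) < liminf (\<lambda>k. ereal (real_of_int (S k)))"
    unfolding l L_def by (simp, linarith)
  from less_LiminfD[OF this] have ev: "\<forall>\<^sub>F k in sequentially. L \<le> S k"
    by (rule eventually_mono) (unfold less_ereal.simps of_int_less_iff, linarith)
  then have "ereal (real_of_int L) \<le> liminf (\<lambda>k. ereal (real_of_int (S k)))"
    by (intro Liminf_bounded) (auto elim: eventually_mono)
  then have x: "x = real_of_int L" unfolding l L_def by (simp, linarith)
  have "\<exists>\<^sub>F k in sequentially. S k = L"
  proof (rule ccontr)
    assume "\<not> (\<exists>\<^sub>F k in sequentially. S k = L)"
    then have "\<forall>\<^sub>F k in sequentially. L + 1 \<le> S k"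
      using ev unfolding not_frequently by eventually_elim simp
    then have "ereal (real_of_int (L + 1)) \<le> liminf (\<lambda>k. ereal (real_of_int (S k)))"
      by (intro Liminf_bounded) (auto elim!: eventually_mono)
    then show False unfolding l x by simp
  qed
  with x ev show ?r by blast
next
  assume ?r
  then obtain L where x: "x = real_of_int L" and ev: "\<forall>\<^sub>F k in sequentially. L \<le> S k"
    and fr: "\<exists>\<^sub>F k in sequentially. S k = L" by blast
  show ?l
  proof (rule antisym)
    show "ereal x \<le> liminf (\<lambda>k. ereal (real_of_int (S k)))"
      using ev x by (intro Liminf_bounded) (auto elim: eventually_mono)
    show "liminf (\<lambda>k. ereal (real_of_int (S k))) \<le> ereal x"
    proof (rule ccontr)
      assume "\<not> ?thesis"
      then have "ereal x < liminf (\<lambda>k. ereal (real_of_int (S k)))" by simp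
      from less_LiminfD[OF this] have "\<forall>\<^sub>F k in sequentially. S k \<noteq> L"
        by (rule eventually_mono) (auto simp: x)
      then show False using fr by (simp add: frequently_def)
    qed
  qed
qed

text \<open>\<open>finite_memory\<close> asks for states in \<open>nat\<close>. An injection of
  \<open>M\<close> into \<open>nat\<close> and its inverse transport a machine over any type, so
  that histories can serve as memory below.\<close>

lemma finite_memory_of_machine:
  assumes "finite M" "m0 \<in> M" "\<And>m v. m \<in> M \<Longrightarrow> upd m v \<in> M"
  shows "finite_memory VE E q0 (\<lambda>h. nxt (foldl upd m0 h) (last h))"
proof -
  obtain e :: "_ \<Rightarrow> nat" where e: "inj_on e M"
    using finite_imp_inj_to_nat_seg[OF \<open>finite M\<close>] by blast
  define d where "d = inv_into M e"
  have de: "d (e m) = m" if "m \<in> M" for m using e that by (simp add: d_def)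
  define upd' where "upd' n v = e (upd (d n) v)" for n v
  have "foldl upd m0 h \<in> M \<and> foldl upd' (e m0) h = e (foldl upd m0 h)" for h
    by (induction h rule: rev_induct) (auto simp: assms upd'_def de)
  moreover have "\<forall>n\<in>e ` M. \<forall>v. upd' n v \<in> e ` M"
    by (auto simp: upd'_def de assms)
  ultimately show ?thesis
    unfolding finite_memory_def using assms(1,2) de
    by (intro exI[of _ "e ` M"] exI[of _ "e m0"] exI[of _ upd'] exI[of _ "\<lambda>n. nxt (d n)"]) auto
qed

section \<open>Accumulated weights of plays and histories\<close>

text \<open>Summing along a function serves plays directly and histories through \<open>(!)\<close>.
  Only the entries \<open>0\<close> to \<open>k\<close> are read, so a sum survives truncation and
  extension beyond \<open>k\<close>.\<close>

definition psum :: "('v \<times> 'v \<Rightarrow> int) \<Rightarrow> (nat \<Rightarrow> 'v) \<Rightarrow> nat \<Rightarrow> int" where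
  "psum w f k = (\<Sum>i<k. w (f i, f (Suc i)))"

lemma psum_cong: "(\<And>i. i \<le> k \<Longrightarrow> f i = g i) \<Longrightarrow> psum w f k = psum w g k"
  unfolding psum_def by (intro sum.cong) auto

lemma psum_take: "k < n \<Longrightarrow> psum w ((!) (take n h)) k = psum w ((!) h) k"
  by (rule psum_cong) simp

lemma psum_append: "k < length h \<Longrightarrow> psum w ((!) (h @ t)) k = psum w ((!) h) k"
  by (rule psum_cong) (simp add: nth_append)

lemma psum_map: "k < n \<Longrightarrow> psum w ((!) (map \<pi> [0..<n])) k = psum w \<pi> k"
  by (rule psum_cong) simp

definition weight :: "('v \<times> 'v \<Rightarrow> int) \<Rightarrow> 'v list \<Rightarrow> int" where
  "weight w h = psum w ((!) h) (length h - 1)"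

lemma weight_snoc:
  assumes "h \<noteq> []"
  shows "weight w (h @ [v]) = weight w h + w (last h, v)"
proof -
  obtain n where n: "length h = Suc n" using assms by (cases h) auto
  have "weight w (h @ [v]) = psum w ((!) (h @ [v])) n + w (h ! n, v)"
    by (simp add: weight_def psum_def n nth_append)
  also have "psum w ((!) (h @ [v])) n = weight w h"
    by (simp add: weight_def n psum_append)
  finally show ?thesis using assms n by (simp add: last_conv_nth)
qed

section \<open>Closed loops and the finite tree cut at them\<close>

definition closes_loop :: "('v \<times> 'v \<Rightarrow> int) \<Rightarrow> real set \<Rightarrow> 'v list \<Rightarrow> nat \<Rightarrow> bool" where
  "closes_loop w I h i \<longleftrightarrow> Suc i < length h \<and> h ! i = last h \<and> psum w ((!) h) i = weight w h \<and>
     real_of_int (weight w h) \<in> I \<and>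
     (\<forall>j. i \<le> j \<and> j < length h \<longrightarrow> weight w h \<le> psum w ((!) h) j)"

text \<open>A history may close several loops; any of their starts will do, and the choice operator
  fixes one.\<close>

definition jump_back :: "('v \<times> 'v \<Rightarrow> int) \<Rightarrow> real set \<Rightarrow> 'v list \<Rightarrow> 'v list" where
  "jump_back w I h =
     (if \<exists>i. closes_loop w I h i then take (Suc (SOME i. closes_loop w I h i)) h else h)"

lemma jump_back_cases:
  obtains (stay) "\<nexists>i. closes_loop w I h i" "jump_back w I h = h"
  | (jump) i where "closes_loop w I h i" "jump_back w I h = take (Suc i) h"
  unfolding jump_back_def by (metis someI_ex)

text \<open>The empty list makes the set closed under prefixes and is the memory before
  \<open>q0\<close> is read. Every prefix is tested, the whole list included, so a branch ends just
  before its first closed loop.\<close>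

definition cut_tree ::
  "'v set \<Rightarrow> ('v \<times> 'v) set \<Rightarrow> ('v \<times> 'v \<Rightarrow> int) \<Rightarrow> 'v \<Rightarrow> real set \<Rightarrow> ('v list \<Rightarrow> 'v) \<Rightarrow> 'v list set" where
  "cut_tree VE E w q0 I \<sigma> = {h. (h = [] \<or> history E q0 h) \<and>
     (\<forall>i. Suc i < length h \<longrightarrow> h ! i \<in> VE \<longrightarrow> h ! Suc i = \<sigma> (take (Suc i) h)) \<and>
     (\<forall>n\<le>length h. \<nexists>i. closes_loop w I (take n h) i)}"

lemma cut_tree_take:
  assumes "h \<in> cut_tree VE E w q0 I \<sigma>"
  shows "take n h \<in> cut_tree VE E w q0 I \<sigma>"
  using assms unfolding cut_tree_def history_def
  by (auto simp: hd_conv_nth min_def)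

lemma cut_tree_snoc:
  assumes h: "h \<in> cut_tree VE E w q0 I \<sigma>" "h \<noteq> []" and "(last h, v) \<in> E"
    and "last h \<in> VE \<Longrightarrow> v = \<sigma> h" and "\<nexists>i. closes_loop w I (h @ [v]) i"
  shows "h @ [v] \<in> cut_tree VE E w q0 I \<sigma>"
proof -
  have step: "Suc i < length h \<or> i = length h - 1 \<and> Suc i = length h" if "Suc i < length (h @ [v])" for i
    using that by auto
  have last: "h ! i = last h" if "Suc i = length h" for i
    using h(2) by (simp add: last_conv_nth flip: that)
  have "history E q0 (h @ [v])"
    using h assms(3) last unfolding cut_tree_def history_def
    by (auto simp: nth_append less_Suc_eq dest!: step)
  moreover have "(h @ [v]) ! Suc i = \<sigma> (take (Suc i) (h @ [v]))"
    if "Suc i < length (h @ [v])" "(h @ [v]) ! i \<in> VE" for i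
    using step[OF that(1)] that(2) h assms(4) last unfolding cut_tree_def
    by (auto simp: nth_append)
  moreover have "\<nexists>i. closes_loop w I (take n (h @ [v])) i" if "n \<le> length (h @ [v])" for n
    using that h assms(5) unfolding cut_tree_def
    by (cases "n = length (h @ [v])") auto
  ultimately show ?thesis unfolding cut_tree_def by blast
qed

text \<open>Pigeonhole: the sum equals its limit inferior at infinitely many late positions, two of
  which carry the same vertex, and no late sum is smaller.\<close>

lemma winning_play_closes_loop:
  assumes "finite V" "range \<pi> \<subseteq> V" and "winning_play I w \<pi>"
  shows "\<exists>n i. closes_loop w I (map \<pi> [0..<n]) i"
proof -
  obtain x where "x \<in> I" "liminf (\<lambda>k. ereal (real_of_int (psum w \<pi> k))) = ereal x"
    using assms(3) unfolding winning_play_def total_def psum_def by blast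
  then obtain L where L: "real_of_int L \<in> I" "\<forall>\<^sub>F k in sequentially. L \<le> psum w \<pi> k"
    "\<exists>\<^sub>F k in sequentially. psum w \<pi> k = L"
    unfolding liminf_int_sequence_iff by blast
  then obtain K where K: "\<And>k. k \<ge> K \<Longrightarrow> L \<le> psum w \<pi> k"
    unfolding eventually_sequentially by blast
  define A where "A = {k. K \<le> k \<and> psum w \<pi> k = L}"
  have "\<exists>\<^sub>F k in sequentially. K \<le> k \<and> psum w \<pi> k = L"
    using frequently_eventually_frequently[OF L(3) eventually_ge_at_top[of K]]
    by (rule frequently_elim1) simp
  then have "infinite A"
    unfolding A_def cofinite_eq_sequentially[symmetric] INFM_iff_infinite .
  moreover have "finite (\<pi> ` A)"
    using assms(1,2) by (meson finite_subset image_subset_iff rangeI subset_iff)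
  ultimately have "\<not> inj_on \<pi> A" using finite_imageD by blast
  then obtain i j where "i \<in> A" "j \<in> A" "\<pi> i = \<pi> j" "i < j"
    unfolding inj_on_def by (metis linorder_neqE_nat)
  then have "closes_loop w I (map \<pi> [0..<Suc j]) i"
    using L(1) K unfolding closes_loop_def weight_def A_def
    by (auto simp: psum_map simp del: upt_Suc) (simp add: nth_append)
  then show ?thesis by blast
qed

text \<open>An infinite branch would be a play consistent with \<open>\<sigma>\<close>, hence
  winning, and so would close a loop within some prefix.\<close>

lemma finite_cut_tree:
  assumes G: "game_graph V VE E q0" and win: "winning_strategy VE E w q0 I \<sigma>"
  shows "finite (cut_tree VE E w q0 I \<sigma>)"
proof (rule ccontr)
  let ?T = "cut_tree VE E w q0 I \<sigma>"
  assume inf: "infinite ?T"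
  have "?T \<subseteq> lists V"
  proof
    fix h assume h: "h \<in> ?T"
    have "h ! i \<in> V" if "i < length h" for i
      using that h G unfolding cut_tree_def history_def game_graph_def
      by (cases i) (auto simp: hd_conv_nth)
    then show "h \<in> lists V" by (auto simp: in_set_conv_nth)
  qed
  moreover have "h \<in> ?T" if "h @ [v] \<in> ?T" for h v
    using cut_tree_take[OF that, of "length h"] by simp
  moreover have "finite V" using G by (simp add: game_graph_def)
  ultimately obtain \<pi> where \<pi>: "\<And>n. map \<pi> [0..<n] \<in> ?T"
    using koenig_lists[OF _ _ inf] by metis
  have hist: "history E q0 (map \<pi> [0..<Suc n])" for n
    using \<pi>[of "Suc n"] unfolding cut_tree_def by simp
  have "play E q0 \<pi>"
    unfolding play_def
  proof (intro conjI allI)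
    show "\<pi> 0 = q0" using hist[of 0] by (simp add: history_def)
    show "(\<pi> i, \<pi> (Suc i)) \<in> E" for i
      using hist[of "Suc i"] unfolding history_def
      by (auto simp del: upt_Suc dest!: spec[of _ i])
  qed
  moreover have "consistent VE \<sigma> \<pi>"
    unfolding consistent_def
  proof (intro allI impI)
    fix i assume "\<pi> i \<in> VE"
    then show "\<pi> (Suc i) = \<sigma> (map \<pi> [0..<Suc i])"
      using \<pi>[of "Suc (Suc i)"] unfolding cut_tree_def
      by (auto simp del: upt_Suc simp: take_map dest!: spec[of _ i])
  qed
  ultimately have "winning_play I w \<pi>" and "range \<pi> \<subseteq> V"
    using win G unfolding winning_strategy_def play_def game_graph_def by auto
  then obtain n i where "closes_loop w I (map \<pi> [0..<n]) i"
    using winning_play_closes_loop[OF \<open>finite V\<close>] by blast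
  moreover have "map \<pi> [0..<n] = take n (map \<pi> [0..<n])" by simp
  ultimately show False using \<pi>[of n] unfolding cut_tree_def by fastforce
qed

section \<open>Payoff of plays whose memory jumps back\<close>

lemma jump_back_play_winning:
  assumes "finite T"
    and in_T: "\<And>k. m k \<in> T" and ne: "\<And>k. m k \<noteq> []"
    and step: "\<And>k. m (Suc k) = jump_back w I (m k @ [\<pi> (Suc k)])"
    and weight: "\<And>k. weight w (m k) = psum w \<pi> k"
  shows "winning_play I w \<pi>"
proof -
  define R where "R = {r \<in> T. \<exists>\<^sub>F k in sequentially. m k = r}"
  have "finite R" using \<open>finite T\<close> by (simp add: R_def)
  \<comment> \<open>Each of the finitely many nodes outside \<open>R\<close> is visited only
    finitely often.\<close>
  have "\<forall>\<^sub>F k in sequentially. \<forall>r\<in>T - R. m k \<noteq> r"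
    using \<open>finite T\<close> by (intro eventually_ball_finite) (auto simp: R_def frequently_def)
  then have ev: "\<forall>\<^sub>F k in sequentially. m k \<in> R"
    by (rule eventually_mono) (use in_T in blast)
  then have "R \<noteq> {}" by (auto dest: eventually_happens')
  then obtain r where r: "r \<in> R" "\<And>s. s \<in> R \<Longrightarrow> weight w r \<le> weight w s"
    using ex_min_if_finite[of "weight w ` R"] \<open>finite R\<close>
    by (metis (no_types, lifting) finite_imageI image_iff image_is_empty linorder_not_less)
  define L where "L = weight w r"
  have ge: "\<forall>\<^sub>F k in sequentially. L \<le> psum w \<pi> k"
    using ev by (rule eventually_mono) (use r(2) weight in \<open>simp add: L_def flip: weight\<close>)
  have fr: "\<exists>\<^sub>F k in sequentially. m k = r" using r(1) by (simp add: R_def)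
  then have freq: "\<exists>\<^sub>F k in sequentially. psum w \<pi> k = L"
    by (rule frequently_elim1) (simp add: L_def flip: weight)
  obtain K where K: "\<And>k. k \<ge> K \<Longrightarrow> L \<le> psum w \<pi> k"
    using ge unfolding eventually_sequentially by blast
  obtain a where a: "a \<ge> K" "m a = r" using fr unfolding frequently_sequentially by blast
  obtain b where b: "b > a" "m b = r"
    using fr unfolding frequently_sequentially by (metis Suc_le_lessD)
  \<comment> \<open>\<open>l\<close> is the first time after \<open>a\<close> at which the memory is
    not a proper extension of \<open>r\<close>; the visit \<open>b\<close> shows that it exists.
    Just before, the memory still has \<open>r\<close> as a prefix.\<close>
  define P where "P j \<longleftrightarrow> a < j \<and> \<not> strict_prefix r (m j)" for j
  define l where "l = (LEAST j. P j)"
  have "P b" using b by (simp add: P_def)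
  then have l: "P l" unfolding l_def by (rule LeastI)
  then obtain n where n: "l = Suc n" "a \<le> n" unfolding P_def by (cases l) auto
  have "prefix r (m n)"
  proof (cases "n = a")
    case False
    then have "a < n" using n by simp
    moreover have "\<not> P n" using n not_less_Least[of n P] unfolding l_def by simp
    ultimately show ?thesis unfolding P_def by auto
  qed (simp add: a)
  then obtain t where t: "m n = r @ t" by (auto simp: prefix_def)
  have "r \<noteq> []" using ne a by metis
  have "real_of_int L \<in> I"
  proof (cases rule: jump_back_cases[of w I "m n @ [\<pi> l]"])
    case stay
    then have "strict_prefix r (m l)" using step[of n] n t by (simp add: strict_prefix_def)
    then show ?thesis using l by (simp add: P_def)
  next
    case (jump i)
    let ?g = "m n @ [\<pi> l]"
    have m_l: "m l = take (Suc i) ?g" using jump step[of n] n by simp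
    have i: "i < length (m n)" using jump(1) by (simp add: closes_loop_def)
    have "Suc i \<le> length r"
    proof (rule ccontr)
      assume "\<not> Suc i \<le> length r"
      then have "strict_prefix r (m l)"
        using i unfolding m_l t by (auto simp: strict_prefix_def)
      then show False using l by (simp add: P_def)
    qed
    \<comment> \<open>The end of \<open>r\<close> is a position on the closed loop, so the loop's
      minimum bounds the weight of \<open>r\<close> from below.\<close>
    then have "i \<le> length r - 1 \<and> length r - 1 < length ?g" by (auto simp: t)
    then have "weight w ?g \<le> psum w ((!) ?g) (length r - 1)"
      using jump(1) unfolding closes_loop_def by blast
    also have "psum w ((!) ?g) (length r - 1) = L"
      using \<open>r \<noteq> []\<close> unfolding L_def weight_def t by (simp add: psum_append)
    finally have "weight w ?g \<le> L" .
    \<comment> \<open>Cutting at the start of the loop keeps the weight, so the bound valid from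
      \<open>K\<close> on applies to the loop's minimum.\<close>
    moreover have "weight w (m l) = weight w ?g"
      using jump(1) unfolding m_l closes_loop_def
      by (simp add: weight_def[of w "take _ _"] psum_take min_def del: take_append)
    then have "L \<le> weight w ?g" using K[of l] weight[of l] n a by simp
    ultimately show ?thesis using jump(1) unfolding closes_loop_def by simp
  qed
  then show ?thesis
    using ge freq liminf_int_sequence_iff[of "psum w \<pi>" "real_of_int L"]
    unfolding winning_play_def total_def psum_def by auto
qed

section \<open>The finite-memory strategy\<close>

theorem mainTheorem18:
  fixes V VE :: "'v set" and E :: "('v \<times> 'v) set" and w :: "'v \<times> 'v \<Rightarrow> int"
    and q0 :: 'v and I :: "real set"
  assumes "game_graph V VE E q0"
    and "real_interval I"
    and "\<exists>\<sigma>. winning_strategy VE E w q0 I \<sigma>"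
  shows "\<exists>\<sigma>. winning_strategy VE E w q0 I \<sigma> \<and> finite_memory VE E q0 \<sigma>"
proof -
  obtain \<sigma> where \<sigma>: "winning_strategy VE E w q0 I \<sigma>" using assms(3) by blast
  define T where "T = cut_tree VE E w q0 I \<sigma>"
  have "finite T" unfolding T_def using finite_cut_tree[OF assms(1) \<sigma>] .
  have Nil: "[] \<in> T" by (simp add: T_def cut_tree_def closes_loop_def)
  \<comment> \<open>The default \<open>[]\<close> keeps the memory in \<open>T\<close> for every
    input vertex; plays consistent with \<open>\<sigma>'\<close> never reach this default.\<close>
  define upd where
    "upd h v = (if jump_back w I (h @ [v]) \<in> T then jump_back w I (h @ [v]) else [])" for h v
  \<comment> \<open>A history not consistent with \<open>\<sigma>'\<close> may leave a memory that
    does not end in the current vertex, where the move of \<open>\<sigma>\<close> can be illegal.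
    Some edge is then taken, to keep \<open>\<sigma>'\<close> a strategy on all histories.\<close>
  define nxt where "nxt h v = (if (v, \<sigma> h) \<in> E then \<sigma> h else (SOME u. (v, u) \<in> E))" for h v
  define \<sigma>' where "\<sigma>' h = nxt (foldl upd [] h) (last h)" for h
  have "finite_memory VE E q0 \<sigma>'"
    unfolding \<sigma>'_def using \<open>finite T\<close> Nil
    by (intro finite_memory_of_machine[of T]) (auto simp: upd_def)
  moreover have "eve_strategy VE E q0 \<sigma>'"
    unfolding eve_strategy_def
  proof (intro allI impI)
    fix h assume "history E q0 h \<and> last h \<in> VE"
    then have "\<exists>u. (last h, u) \<in> E" using assms(1) by (auto simp: game_graph_def)
    then show "(last h, \<sigma>' h) \<in> E" by (auto simp: \<sigma>'_def nxt_def intro: someI_ex)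
  qed
  moreover have "winning_play I w \<pi>" if \<pi>: "play E q0 \<pi>" "consistent VE \<sigma>' \<pi>" for \<pi>
  proof -
    define m where "m k = foldl upd [] (map \<pi> [0..<Suc k])" for k
    have m_Suc: "m (Suc k) = upd (m k) (\<pi> (Suc k))" for k by (simp add: m_def)
    have jb_single: "jump_back w I [q0] = [q0]" by (simp add: jump_back_def closes_loop_def)
    have "[q0] \<in> T"
      by (auto simp: T_def cut_tree_def closes_loop_def history_def)
    then have m_0: "m 0 = [q0]"
      using \<pi>(1) by (simp add: m_def upd_def jb_single play_def)
    \<comment> \<open>The invariant says that the memory is a node of \<open>T\<close> with the
      vertex and the accumulated weight of the actual play.\<close>
    have next_step: "m (Suc k) = jump_back w I (m k @ [\<pi> (Suc k)]) \<and> m (Suc k) \<in> T \<and>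
        m (Suc k) \<noteq> [] \<and> last (m (Suc k)) = \<pi> (Suc k) \<and> weight w (m (Suc k)) = psum w \<pi> (Suc k)"
      if k: "m k \<in> T" "m k \<noteq> []" "last (m k) = \<pi> k" "weight w (m k) = psum w \<pi> k" for k
    proof -
      let ?g = "m k @ [\<pi> (Suc k)]"
      have E: "(last (m k), \<pi> (Suc k)) \<in> E" using \<pi>(1) k(3) by (simp add: play_def)
      \<comment> \<open>The memory is itself a history ending in the current vertex, so the move of
        \<open>\<sigma>\<close> there is legal and \<open>nxt\<close> does not fall back on its
        default.\<close>
      have S: "\<pi> (Suc k) = \<sigma> (m k)" if "last (m k) \<in> VE"
      proof -
        have "history E q0 (m k)" using k by (simp add: T_def cut_tree_def)
        then have "(\<pi> k, \<sigma> (m k)) \<in> E"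
          using \<sigma> that k(3) unfolding winning_strategy_def eve_strategy_def by metis
        moreover have "\<pi> (Suc k) = nxt (m k) (\<pi> k)"
          using \<pi>(2) that k(3) unfolding consistent_def \<sigma>'_def m_def by simp
        ultimately show ?thesis by (simp add: nxt_def)
      qed
      have W: "weight w ?g = psum w \<pi> (Suc k)"
        using k by (simp add: weight_snoc psum_def)
      show ?thesis
      proof (cases rule: jump_back_cases[of w I ?g])
        case stay
        then have "?g \<in> T" using cut_tree_snoc k E S unfolding T_def by metis
        then show ?thesis using stay W by (simp add: m_Suc upd_def)
      next
        case (jump i)
        then have i: "i < length (m k)" "?g ! i = \<pi> (Suc k)"
          by (auto simp: closes_loop_def)
        then have tk: "take (Suc i) ?g = take (Suc i) (m k)" by simp
        then have T: "take (Suc i) ?g \<in> T"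
          using cut_tree_take k(1) unfolding T_def by metis
        have "last (take (Suc i) ?g) = \<pi> (Suc k)"
          using i by (simp add: take_Suc_conv_app_nth nth_append)
        moreover have "weight w (take (Suc i) ?g) = weight w ?g"
          using jump(1) unfolding closes_loop_def
          by (simp add: weight_def[of w "take _ _"] psum_take min_def del: take_append)
        ultimately show ?thesis using T jump(2) W k(2) by (simp add: m_Suc upd_def)
      qed
    qed
    have inv: "m k \<in> T \<and> m k \<noteq> [] \<and> last (m k) = \<pi> k \<and> weight w (m k) = psum w \<pi> k" for k
    proof (induction k)
      case 0
      then show ?case using \<open>[q0] \<in> T\<close> \<pi>(1) by (simp add: m_0 weight_def psum_def play_def)
    qed (use next_step in blast)
    show ?thesis
      using jump_back_play_winning[OF \<open>finite T\<close>, of m] inv next_step by blast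
  qed
  ultimately show ?thesis unfolding winning_strategy_def by blast
qed

end
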